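(* Given $m\ge \max_{1\le i\le s,\,1\le j\le t}\{n_{ij}+d+2\}$ distinct nodes $\mathcal X=\{x_\ell\}_{\ell=1}^m$ in $\Omega\subset\mathbb C$, let $\eta_2$ be the infimum of the linearized problem $$\eta_2:=\inf_{\eta\in\mathbb R,\ p_{ij}\in\mathbb P_{n_{ij}},\ 0\not\equiv q\in\mathbb P_d}\eta\quad\text{s.t.}\quad \sum_{i=1}^s\sum_{j=1}^t|f_{ij}(x_\ell)q(x_\ell)-p_{ij}(x_\ell)|^2\le\eta\,|q(x_\ell)|^2,\quad 1\le\ell\le m.$$ If $0\le d\le\min_{1\le i\le s,\,1\le j\le t}\{n_{ij}\}$, then $\eta_2=\eta_\infty$, where $\eta_\infty=\inf_{R\in\mathscr R_{(s,t)}}\max_{1\le\ell\le m}\|F(x_\ell)-R(x_\ell)\|_{\mathrm F}^2$. Furthermore, in this case, whenever the minimax problem defining $\eta_\infty$ has a solution $R=[p_{ij}/q]\in\mathscr R_{(s,t)}$ with $q(x_\ell)\ne0$ for all $1\le\ell\le m$, the tuple $(\eta_\infty,\{p_{ij}\},q)$ is a solution of the linearized problem.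
   Context: $s,t\ge1$ and $d,n_{ij}\ge 0$ are given integers; $\mathbb P_n$ is the set of complex polynomials of degree at most $n$; $F(x_\ell)=[f_{ij}(x_\ell)]\in\mathbb C^{s\times t}$ are given data at the nodes; $\|\cdot\|_{\mathrm F}$ is the Frobenius norm. $\mathscr R_{(s,t)}$ is the set of matrix-valued rational functions $R=[r_{ij}]$ of size $s\times t$ with $r_{ij}=p_{ij}/q$, $p_{ij}\in\mathbb P_{n_{ij}}$, and a common denominator $0\not\equiv q\in\mathbb P_d$. If $q$ vanishes at a node, the value of $r_{ij}$ there is understood after cancelling common zeros of numerator and denominator; if a pole remains at a node, the error of $R$ at that node is $+\infty$. *)

theory Defs
  imports
    "HOL-Analysis.Analysis"
    "HOL-Computational_Algebra.Computational_Algebra"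
    "HOL-Computational_Algebra.Field_as_Ring"
begin

text \<open>
  The s-by-t matrices are indexed by two finite types; types are nonempty, so both sizes are at
  least 1. The library norm on \<^typ>\<open>complex ^ 't ^ 's\<close> is the Frobenius norm:
\<close>

lemma norm_matrix_eq_Frobenius:
  fixes A :: "complex ^ 't ^ 's"
  shows "(norm A)\<^sup>2 = (\<Sum>i\<in>UNIV. \<Sum>j\<in>UNIV. (cmod (A $ i $ j))\<^sup>2)"
  by (simp add: norm_vec_def L2_set_def sum_nonneg)

text \<open>
  A rational function is an element of the fraction field of \<^typ>\<open>complex poly\<close>, so that it does
  not depend on the choice of numerator and denominator. Its coprime representation
  \<^const>\<open>quot_of_fract\<close> gives the poles and values that remain after cancelling common zeros.
\<close>

definition has_pole_at :: "complex poly fract \<Rightarrow> complex \<Rightarrow> bool" where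
  "has_pole_at r z \<longleftrightarrow> poly (snd (quot_of_fract r)) z = 0"

definition rat_value :: "complex poly fract \<Rightarrow> complex \<Rightarrow> complex" where
  "rat_value r z = poly (fst (quot_of_fract r)) z / poly (snd (quot_of_fract r)) z"

definition admissible ::
  "('s \<Rightarrow> 't \<Rightarrow> nat) \<Rightarrow> nat \<Rightarrow> ('s \<Rightarrow> 't \<Rightarrow> complex poly) \<Rightarrow> complex poly \<Rightarrow> bool" where
  "admissible n d p q \<longleftrightarrow> (\<forall>i j. degree (p i j) \<le> n i j) \<and> q \<noteq> 0 \<and> degree q \<le> d"

definition rat_matrix ::
  "('s \<Rightarrow> 't \<Rightarrow> complex poly) \<Rightarrow> complex poly \<Rightarrow> complex poly fract ^ 't ^ 's" where
  "rat_matrix p q = (\<chi> i j. Fraction_Field.Fract (p i j) q)"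

definition rat_matrices ::
  "('s \<Rightarrow> 't \<Rightarrow> nat) \<Rightarrow> nat \<Rightarrow> (complex poly fract ^ 't ^ 's) set" where
  "rat_matrices n d = {rat_matrix p q | p q. admissible n d p q}"

definition node_error ::
  "(complex \<Rightarrow> complex ^ 't ^ 's) \<Rightarrow> complex poly fract ^ 't ^ 's \<Rightarrow> complex \<Rightarrow> ereal" where
  "node_error F R z =
     (if \<exists>i j. has_pole_at (R $ i $ j) z then \<infinity>
      else ereal ((norm (F z - (\<chi> i j. rat_value (R $ i $ j) z)))\<^sup>2))"

definition max_error ::
  "(complex \<Rightarrow> complex ^ 't ^ 's) \<Rightarrow> complex set \<Rightarrow> complex poly fract ^ 't ^ 's \<Rightarrow> ereal" where
  "max_error F X R = (MAX z\<in>X. node_error F R z)"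

definition eta_inf ::
  "(complex \<Rightarrow> complex ^ 't ^ 's) \<Rightarrow> complex set \<Rightarrow> ('s \<Rightarrow> 't \<Rightarrow> nat) \<Rightarrow> nat \<Rightarrow> ereal" where
  "eta_inf F X n d = (INF R\<in>rat_matrices n d. max_error F X R)"

definition minimax_solution ::
  "(complex \<Rightarrow> complex ^ 't ^ 's) \<Rightarrow> complex set \<Rightarrow> ('s \<Rightarrow> 't \<Rightarrow> nat) \<Rightarrow> nat \<Rightarrow>
    complex poly fract ^ 't ^ 's \<Rightarrow> bool" where
  "minimax_solution F X n d R \<longleftrightarrow> R \<in> rat_matrices n d \<and> max_error F X R = eta_inf F X n d"

definition lin_feasible ::
  "(complex \<Rightarrow> complex ^ 't ^ 's) \<Rightarrow> complex set \<Rightarrow> ('s \<Rightarrow> 't \<Rightarrow> nat) \<Rightarrow> nat \<Rightarrow>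
    real \<Rightarrow> ('s \<Rightarrow> 't \<Rightarrow> complex poly) \<Rightarrow> complex poly \<Rightarrow> bool" where
  "lin_feasible F X n d \<eta> p q \<longleftrightarrow> admissible n d p q \<and>
     (\<forall>z\<in>X. (\<Sum>i\<in>UNIV. \<Sum>j\<in>UNIV. (cmod (F z $ i $ j * poly q z - poly (p i j) z))\<^sup>2)
              \<le> \<eta> * (cmod (poly q z))\<^sup>2)"

definition eta2 ::
  "(complex \<Rightarrow> complex ^ 't ^ 's) \<Rightarrow> complex set \<Rightarrow> ('s \<Rightarrow> 't \<Rightarrow> nat) \<Rightarrow> nat \<Rightarrow> ereal" where
  "eta2 F X n d = Inf {ereal \<eta> | \<eta> p q. lin_feasible F X n d \<eta> p q}"

definition lin_solution ::
  "(complex \<Rightarrow> complex ^ 't ^ 's) \<Rightarrow> complex set \<Rightarrow> ('s \<Rightarrow> 't \<Rightarrow> nat) \<Rightarrow> nat \<Rightarrow>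
    real \<Rightarrow> ('s \<Rightarrow> 't \<Rightarrow> complex poly) \<Rightarrow> complex poly \<Rightarrow> bool" where
  "lin_solution F X n d \<eta> p q \<longleftrightarrow> lin_feasible F X n d \<eta> p q \<and> ereal \<eta> = eta2 F X n d"

end

theory Submission
  imports Defs
begin

text \<open>
  Both problems compare the same quantities as long as \<open>q\<close> has no zero at a node. A minimax
  candidate of finite error has no poles at the nodes, so every zero of \<open>q\<close> at a node cancels
  against all the numerators and can be divided out. In the linearized problem a zero of \<open>q\<close> at a
  node forces all numerators to vanish there; there are at most \<open>d\<close> such nodes, and since
  \<open>d \<le> n i j\<close> the data there can be interpolated by polynomials \<open>h i j\<close> of admissible degree. The
  perturbation \<open>(p i j + \<epsilon> h i j) / (q + \<epsilon>)\<close> then has error 0 at these nodes, and at the remaining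
  nodes its error tends to that of \<open>p / q\<close> as \<open>\<epsilon> \<rightarrow> 0\<close>.
\<close>

section \<open>Poles and values of a fraction at a point\<close>

text \<open>Links an arbitrary representation to the coprime one. Being a polynomial identity, it
  can also be evaluated where \<open>q\<close> vanishes.\<close>

lemma quot_of_fract_Fract_cross:
  fixes p q :: "complex poly"
  assumes "q \<noteq> 0"
  shows "p * snd (quot_of_fract (Fraction_Field.Fract p q)) =
         q * fst (quot_of_fract (Fraction_Field.Fract p q))"
proof -
  let ?r = "Fraction_Field.Fract p q"
  have "Fraction_Field.Fract (fst (quot_of_fract ?r)) (snd (quot_of_fract ?r)) = ?r"
    by (rule Fract_quot_of_fract)
  then have "fst (quot_of_fract ?r) * q = p * snd (quot_of_fract ?r)"
    using assms by (subst (asm) eq_fract) auto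
  then show ?thesis by (simp add: mult.commute)
qed

text \<open>If the reduced denominator vanished at \<open>z\<close>, the cross identity would make
  the reduced numerator vanish there too, against coprimality.\<close>

lemma has_pole_at_Fract:
  assumes "poly q z \<noteq> 0"
  shows "\<not> has_pole_at (Fraction_Field.Fract p q) z"
proof
  let ?a = "fst (quot_of_fract (Fraction_Field.Fract p q))"
  let ?b = "snd (quot_of_fract (Fraction_Field.Fract p q))"
  assume "has_pole_at (Fraction_Field.Fract p q) z"
  then have b: "poly ?b z = 0" by (simp add: has_pole_at_def)
  have "q \<noteq> 0" using assms by auto
  then have "poly (p * ?b) z = poly (q * ?a) z"
    by (rule arg_cong[OF quot_of_fract_Fract_cross])
  with b assms have a: "poly ?a z = 0" by simp
  from a b have "[:- z, 1:] dvd ?a" "[:- z, 1:] dvd ?b"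
    by (simp_all add: poly_eq_0_iff_dvd)
  moreover have "coprime ?a ?b" by (rule coprime_quot_of_fract)
  ultimately have "is_unit [:- z, 1:]" by (rule coprime_common_divisor[rotated])
  then show False by (simp add: is_unit_pCons_iff)
qed

lemma rat_value_Fract:
  assumes "poly q z \<noteq> 0"
  shows "rat_value (Fraction_Field.Fract p q) z = poly p z / poly q z"
proof -
  let ?a = "fst (quot_of_fract (Fraction_Field.Fract p q))"
  let ?b = "snd (quot_of_fract (Fraction_Field.Fract p q))"
  have "q \<noteq> 0" using assms by auto
  then have "poly (p * ?b) z = poly (q * ?a) z"
    by (rule arg_cong[OF quot_of_fract_Fract_cross])
  moreover have "poly ?b z \<noteq> 0"
    using has_pole_at_Fract[OF assms, of p] by (simp add: has_pole_at_def)
  ultimately show ?thesis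
    using assms by (simp add: rat_value_def field_simps)
qed

lemma numerator_root_of_no_pole:
  assumes "q \<noteq> 0" and "poly q z = 0" and "\<not> has_pole_at (Fraction_Field.Fract p q) z"
  shows "poly p z = 0"
proof -
  let ?a = "fst (quot_of_fract (Fraction_Field.Fract p q))"
  let ?b = "snd (quot_of_fract (Fraction_Field.Fract p q))"
  have "poly (p * ?b) z = poly (q * ?a) z"
    by (rule arg_cong[OF quot_of_fract_Fract_cross[OF assms(1)]])
  with assms show ?thesis by (simp add: has_pole_at_def)
qed

section \<open>Node errors and linearized constraints\<close>

lemma node_error_rat_matrix:
  fixes F :: "complex \<Rightarrow> complex ^ 't ^ 's"
  assumes "poly q z \<noteq> 0"
  shows "node_error F (rat_matrix p q) z =
    ereal ((\<Sum>i\<in>UNIV. \<Sum>j\<in>UNIV. (cmod (F z $ i $ j * poly q z - poly (p i j) z))\<^sup>2)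
           / (cmod (poly q z))\<^sup>2)"
proof -
  have "(cmod (F z $ i $ j - poly (p i j) z / poly q z))\<^sup>2 =
        (cmod (F z $ i $ j * poly q z - poly (p i j) z))\<^sup>2 / (cmod (poly q z))\<^sup>2" for i j
  proof -
    have "F z $ i $ j - poly (p i j) z / poly q z =
          (F z $ i $ j * poly q z - poly (p i j) z) / poly q z"
      using assms by (simp add: field_simps)
    then show ?thesis by (simp add: norm_divide power_divide)
  qed
  then show ?thesis
    using assms
    by (simp add: node_error_def rat_matrix_def has_pole_at_Fract rat_value_Fract
        norm_matrix_eq_Frobenius sum_divide_distrib)
qed

text \<open>Multiplying the error at each node by the positive number
  \<open>(cmod (poly q z))\<^sup>2\<close> gives the linearized constraint. Both inequalities
  between the two infima pass through this equivalence.\<close>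

lemma max_error_le_iff_lin_feasible:
  fixes F :: "complex \<Rightarrow> complex ^ 't ^ 's"
  assumes "finite X" and "X \<noteq> {}" and "admissible n d p q" and "\<And>z. z \<in> X \<Longrightarrow> poly q z \<noteq> 0"
  shows "max_error F X (rat_matrix p q) \<le> ereal \<eta> \<longleftrightarrow> lin_feasible F X n d \<eta> p q"
  using assms
  by (auto simp: max_error_def lin_feasible_def node_error_rat_matrix divide_le_eq)

text \<open>Excludes \<open>-\<infinity>\<close>, so that an error other than
  \<open>\<infinity>\<close> is a real number.\<close>

lemma max_error_nonneg:
  assumes "finite X" and "X \<noteq> {}"
  shows "0 \<le> max_error F X R"
proof -
  from assms obtain z where "z \<in> X" by blast
  have "0 \<le> node_error F R z" by (simp add: node_error_def)
  with assms \<open>z \<in> X\<close> show ?thesis by (auto simp: max_error_def Max_ge_iff)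
qed

text \<open>Induction on the degree of \<open>q\<close>: a node zero of \<open>q\<close> is a zero
  of every numerator, and dividing all of them by the same linear factor keeps the denominator
  common and the fractions unchanged.\<close>

lemma cancel_node_roots:
  assumes "admissible n d p q" and "\<And>z i j. z \<in> X \<Longrightarrow> \<not> has_pole_at (rat_matrix p q $ i $ j) z"
  shows "\<exists>p' q'. admissible n d p' q' \<and> rat_matrix p' q' = rat_matrix p q \<and>
           (\<forall>z\<in>X. poly q' z \<noteq> 0)"
  using assms
proof (induction "degree q" arbitrary: p q rule: less_induct)
  case less
  show ?case
  proof (cases "\<forall>z\<in>X. poly q z \<noteq> 0")
    case True
    with less.prems show ?thesis by blast
  next
    case False
    then obtain z where z: "z \<in> X" "poly q z = 0" by blast
    have q0: "q \<noteq> 0" and dq: "degree q \<le> d" and dp: "\<And>i j. degree (p i j) \<le> n i j"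
      using less.prems(1) by (auto simp: admissible_def)
    let ?l = "[:- z, 1:]"
    have "poly (p i j) z = 0" for i j
      using numerator_root_of_no_pole[OF q0 z(2)] less.prems(2)[OF z(1)]
      by (simp add: rat_matrix_def)
    then have "\<exists>p1. \<forall>i j. p i j = ?l * p1 i j"
      by (simp add: poly_eq_0_iff_dvd dvd_def) metis
    then obtain p1 where p1: "\<And>i j. p i j = ?l * p1 i j" by blast
    obtain q1 where q1: "q = ?l * q1"
      using z(2) by (auto simp: poly_eq_0_iff_dvd elim: dvdE)
    with q0 have q10: "q1 \<noteq> 0" by auto
    \<comment> \<open>This fails for \<open>r = 0\<close>, hence the separate case of a zero
      numerator below.\<close>
    have deg: "degree (?l * r) = Suc (degree r)" if "r \<noteq> 0" for r :: "complex poly"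
      using that by (subst degree_mult_eq) auto
    have "degree (p1 i j) \<le> n i j" for i j
      using dp[of i j] deg[of "p1 i j"] p1[of i j] by (cases "p1 i j = 0") auto
    then have adm: "admissible n d p1 q1"
      using dq deg[OF q10] q10 q1 by (auto simp: admissible_def)
    have same: "rat_matrix p1 q1 = rat_matrix p q"
    proof -
      have "p1 i j * q = p i j * q1" for i j
        by (simp only: p1 q1 mult.assoc mult.left_commute)
      then show ?thesis
        using q10 q0 by (simp add: rat_matrix_def vec_eq_iff eq_fract)
    qed
    have "degree q1 < degree q" using deg[OF q10] q1 by simp
    from less.hyps[OF this adm] less.prems(2) show ?thesis by (simp add: same)
  qed
qed

section \<open>Interpolation and perturbation at zeros of the denominator\<close>

lemma polynomial_interpolation:
  fixes f :: "'a :: field \<Rightarrow> 'a"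
  assumes "finite A"
  shows "\<exists>h. degree h \<le> card A - 1 \<and> (\<forall>z\<in>A. poly h z = f z)"
  using assms
proof (induction A rule: finite_induct)
  case empty
  \<comment> \<open>Subtraction is truncated, so the bound for no points is 0.\<close>
  have "degree (0 :: 'a poly) \<le> card {} - 1" by simp
  then show ?case by blast
next
  case (insert x A)
  then obtain h where h: "degree h \<le> card A - 1" "\<forall>z\<in>A. poly h z = f z" by blast
  \<comment> \<open>Newton's form: \<open>?w\<close> vanishes on the old points, so a multiple of it
    corrects the value at \<open>x\<close> alone.\<close>
  let ?w = "\<Prod>a\<in>A. [:- a, 1:]"
  let ?g = "h + smult ((f x - poly h x) / poly ?w x) ?w"
  have "poly ?w x \<noteq> 0" using insert by (auto simp: poly_prod)
  then have "poly ?g x = f x" by simp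
  moreover have "poly ?g z = f z" if "z \<in> A" for z
  proof -
    have "poly ?w z = 0" using that insert by (auto simp: poly_prod)
    with h that show ?thesis by simp
  qed
  moreover have "degree ?w \<le> card A"
    using degree_prod_sum_le[OF insert.hyps(1), of "\<lambda>a. [:- a, 1:]"] by simp
  then have "degree ?g \<le> card A"
    using h(1) by (intro degree_add_le order.trans[OF degree_smult_le]) auto
  then have "degree ?g \<le> card (insert x A) - 1" using insert by simp
  ultimately show ?case by (intro exI[of _ ?g]) auto
qed

text \<open>The perturbed fractions only approach the level \<open>\<eta>\<close>, so the bound is
  proved for \<open>\<eta> + \<delta>\<close> with every \<delta> > 0.\<close>

lemma eta_inf_le_of_lin_feasible:
  fixes F :: "complex \<Rightarrow> complex ^ 't ^ 's"
  assumes X: "finite X" "d < card X" and dn: "\<And>i j. d \<le> n i j"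
    and feas: "lin_feasible F X n d \<eta> p q"
  shows "eta_inf F X n d \<le> ereal \<eta>"
proof (rule ereal_le_epsilon2)
  fix \<delta> :: real assume "\<delta> > 0"
  have q0: "q \<noteq> 0" and dq: "degree q \<le> d" and dp: "\<And>i j. degree (p i j) \<le> n i j"
    using feas by (auto simp: lin_feasible_def admissible_def)
  define E where "E u v z =
      (\<Sum>i\<in>UNIV. \<Sum>j\<in>UNIV. (cmod (F z $ i $ j * poly v z - poly (u i j) z))\<^sup>2)"
    for u :: "'s \<Rightarrow> 't \<Rightarrow> complex poly" and v z
  have E_nonneg: "0 \<le> E u v z" for u v z by (simp add: E_def sum_nonneg)
  have le: "E p q z \<le> \<eta> * (cmod (poly q z))\<^sup>2" if "z \<in> X" for z
    using feas that by (simp add: lin_feasible_def E_def)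
  define Z where "Z = {z \<in> X. poly q z = 0}"
  have finZ: "finite Z" using X by (simp add: Z_def)
  have "card Z \<le> card {z. poly q z = 0}"
    using q0 by (intro card_mono) (auto simp: Z_def poly_roots_finite)
  also have "\<dots> \<le> degree q" using q0 by (rule card_poly_roots_bound)
  finally have cardZ: "card Z \<le> d" using dq by simp
  \<comment> \<open>A node off the zeros of \<open>q\<close> exists because
    \<open>d < card X\<close>; its constraint forces \<eta> \<ge> 0.\<close>
  have "Z \<noteq> X" using cardZ X by auto
  then obtain y where y: "y \<in> X" "poly q y \<noteq> 0" by (auto simp: Z_def)
  have "0 \<le> \<eta> * (cmod (poly q y))\<^sup>2" using le[OF y(1)] E_nonneg[of p q y] by linarith
  then have \<eta>0: "0 \<le> \<eta>" using y(2) by (simp add: zero_le_mult_iff)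
  have pZ: "poly (p i j) z = 0" if "z \<in> Z" for z i j
  proof -
    have "E p q z \<le> 0" using le[of z] that by (simp add: Z_def)
    then have "E p q z = 0" using E_nonneg[of p q z] by simp
    then show ?thesis
      using that by (simp add: E_def Z_def sum_nonneg_eq_0_iff sum_nonneg)
  qed
  have "\<forall>i j. \<exists>h. degree h \<le> card Z - 1 \<and> (\<forall>z\<in>Z. poly h z = F z $ i $ j)"
    by (intro allI polynomial_interpolation finZ)
  then obtain h where
    hdeg: "\<And>i j. degree (h i j) \<le> card Z - 1" and
    hval: "\<And>i j z. z \<in> Z \<Longrightarrow> poly (h i j) z = F z $ i $ j"
    by metis
  define pe where "pe \<epsilon> i j = p i j + smult (of_real \<epsilon>) (h i j)" for \<epsilon> :: real and i j
  define qe where "qe \<epsilon> = q + [:of_real \<epsilon>:]" for \<epsilon> :: real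
  have dpe: "degree (pe \<epsilon> i j) \<le> n i j" for \<epsilon> i j
  proof -
    \<comment> \<open>For empty \<open>Z\<close> the truncated bound is 0, which is
      harmless.\<close>
    have "degree (h i j) \<le> n i j" using hdeg[of i j] cardZ dn[of i j] by linarith
    then show ?thesis unfolding pe_def
      by (intro degree_add_le dp order.trans[OF degree_smult_le])
  qed
  have dqe: "degree (qe \<epsilon>) \<le> d" for \<epsilon>
    unfolding qe_def using dq by (intro degree_add_le) auto
  have "\<forall>\<^sub>F \<epsilon> in at_right 0. poly (qe \<epsilon>) z \<noteq> 0 \<and>
          E (pe \<epsilon>) (qe \<epsilon>) z \<le> (\<eta> + \<delta>) * (cmod (poly (qe \<epsilon>) z))\<^sup>2" if "z \<in> X" for z
  proof (cases "z \<in> Z")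
    case True
    \<comment> \<open>Here \<open>p i j\<close> and \<open>q\<close> vanish, leaving \<epsilon>
      times the datum as numerator over the denominator \<epsilon>; for \<epsilon> > 0 the latter is
      nonzero.\<close>
    have "E (pe \<epsilon>) (qe \<epsilon>) z = 0" for \<epsilon>
      using True hval pZ[OF True] by (simp add: E_def pe_def qe_def Z_def)
    moreover have "\<forall>\<^sub>F \<epsilon> in at_right (0::real). \<epsilon> > 0"
      by (rule eventually_at_right_less)
    ultimately show ?thesis
      using True \<eta>0 \<open>\<delta> > 0\<close> by (auto simp: qe_def Z_def elim!: eventually_mono)
  next
    case False
    then have qz: "poly q z \<noteq> 0" using that by (simp add: Z_def)
    have tq: "((\<lambda>\<epsilon>. poly (qe \<epsilon>) z) \<longlongrightarrow> poly q z) (at_right 0)"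
      unfolding qe_def by (auto intro!: tendsto_eq_intros)
    have tE: "((\<lambda>\<epsilon>. E (pe \<epsilon>) (qe \<epsilon>) z) \<longlongrightarrow> E p q z) (at_right 0)"
      unfolding E_def pe_def qe_def by (auto intro!: tendsto_eq_intros sum.cong)
    have tr: "((\<lambda>\<epsilon>. (\<eta> + \<delta>) * (cmod (poly (qe \<epsilon>) z))\<^sup>2)
               \<longlongrightarrow> (\<eta> + \<delta>) * (cmod (poly q z))\<^sup>2) (at_right 0)"
      by (intro tendsto_intros tq)
    \<comment> \<open>The slack \<delta> makes the constraint strict where \<open>q\<close> is
      nonzero, and a strict inequality survives small \<epsilon>.\<close>
    have "E p q z < (\<eta> + \<delta>) * (cmod (poly q z))\<^sup>2"
      using le[OF that] \<open>\<delta> > 0\<close> qz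
      by (smt (verit) mult_strict_right_mono zero_less_norm_iff zero_less_power)
    from order_tendstoD(2)[OF tendsto_diff[OF tE tr], of 0] this
    have "\<forall>\<^sub>F \<epsilon> in at_right 0.
            E (pe \<epsilon>) (qe \<epsilon>) z - (\<eta> + \<delta>) * (cmod (poly (qe \<epsilon>) z))\<^sup>2 < 0" by simp
    moreover have "\<forall>\<^sub>F \<epsilon> in at_right 0. poly (qe \<epsilon>) z \<noteq> 0"
      using tendsto_imp_eventually_ne[OF tq qz] .
    ultimately show ?thesis by eventually_elim auto
  qed
  \<comment> \<open>The nodes are finitely many, so one \<epsilon> serves them all.\<close>
  then have "\<forall>\<^sub>F \<epsilon> in at_right 0. \<forall>z\<in>X. poly (qe \<epsilon>) z \<noteq> 0 \<and>
          E (pe \<epsilon>) (qe \<epsilon>) z \<le> (\<eta> + \<delta>) * (cmod (poly (qe \<epsilon>) z))\<^sup>2"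
    using X(1) by (simp add: eventually_ball_finite_distrib)
  then obtain \<epsilon> where \<epsilon>: "\<And>z. z \<in> X \<Longrightarrow> poly (qe \<epsilon>) z \<noteq> 0"
      "\<And>z. z \<in> X \<Longrightarrow> E (pe \<epsilon>) (qe \<epsilon>) z \<le> (\<eta> + \<delta>) * (cmod (poly (qe \<epsilon>) z))\<^sup>2"
    using eventually_happens'[OF trivial_limit_at_right_real] by blast
  have "qe \<epsilon> \<noteq> 0" using \<epsilon>(1)[OF y(1)] by auto
  then have adm: "admissible n d (pe \<epsilon>) (qe \<epsilon>)"
    using dpe dqe by (simp add: admissible_def)
  with \<epsilon>(2) have "lin_feasible F X n d (\<eta> + \<delta>) (pe \<epsilon>) (qe \<epsilon>)"
    by (simp add: lin_feasible_def E_def)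
  then have "max_error F X (rat_matrix (pe \<epsilon>) (qe \<epsilon>)) \<le> ereal (\<eta> + \<delta>)"
    using max_error_le_iff_lin_feasible[OF X(1) _ adm \<epsilon>(1)] y(1) by blast
  moreover have "eta_inf F X n d \<le> max_error F X (rat_matrix (pe \<epsilon>) (qe \<epsilon>))"
    unfolding eta_inf_def using adm by (intro INF_lower) (auto simp: rat_matrices_def)
  ultimately show "eta_inf F X n d \<le> ereal \<eta> + ereal \<delta>" by simp
qed

section \<open>Comparison of the two infima\<close>

text \<open>A finite error is itself a feasible level of the linearized problem, witnessed by the
  representation left after cancellation.\<close>

lemma eta2_le_max_error:
  fixes F :: "complex \<Rightarrow> complex ^ 't ^ 's"
  assumes X: "finite X" "X \<noteq> {}" and R: "R \<in> rat_matrices n d"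
  shows "eta2 F X n d \<le> max_error F X R"
proof (cases "max_error F X R = \<infinity>")
  case False
  from R obtain p q where pq: "admissible n d p q" and Rpq: "R = rat_matrix p q"
    by (auto simp: rat_matrices_def)
  have "\<not> has_pole_at (R $ i $ j) z" if "z \<in> X" for z i j
  proof
    assume "has_pole_at (R $ i $ j) z"
    then have "node_error F R z = \<infinity>" by (auto simp: node_error_def)
    moreover have "node_error F R z \<le> max_error F X R"
      using X that by (auto simp: max_error_def)
    ultimately show False using False by simp
  qed
  then obtain p' q' where pq': "admissible n d p' q'" "R = rat_matrix p' q'"
      "\<And>z. z \<in> X \<Longrightarrow> poly q' z \<noteq> 0"
    using cancel_node_roots[OF pq, of X] by (auto simp: Rpq)
  obtain \<eta> where \<eta>: "max_error F X R = ereal \<eta>"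
    using max_error_nonneg[OF X, of F R] False by (cases "max_error F X R") auto
  then have "lin_feasible F X n d \<eta> p' q'"
    using max_error_le_iff_lin_feasible[OF X pq'(1,3), of F \<eta>] pq'(2) by simp
  then show ?thesis unfolding eta2_def \<eta> by (intro Inf_lower) blast
qed simp

theorem theorem2p2:
  fixes F :: "complex \<Rightarrow> complex ^ 't ^ 's"
    and \<Omega> X :: "complex set"
    and n :: "'s \<Rightarrow> 't \<Rightarrow> nat"
    and d m :: nat
  assumes "finite X" and "card X = m" and "X \<subseteq> \<Omega>"
    and "m \<ge> (MAX (i, j)\<in>UNIV. n i j + d + 2)"
    and "d \<le> (MIN (i, j)\<in>UNIV. n i j)"
  shows "eta2 F X n d = eta_inf F X n d \<and>
    (\<forall>p q. admissible n d p q \<longrightarrow> minimax_solution F X n d (rat_matrix p q) \<longrightarrow>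
       (\<forall>z\<in>X. poly q z \<noteq> 0) \<longrightarrow>
       (\<exists>\<eta>. ereal \<eta> = eta_inf F X n d \<and> lin_solution F X n d \<eta> p q))"
proof -
  have dn: "d \<le> n i j" for i j
    using assms(5) by auto
  have "n i j + d + 2 \<le> m" for i j
    using assms(4) by auto
  \<comment> \<open>Index types are nonempty, so any pair of indices, here \<open>undefined\<close>,
    yields the bound.\<close>
  from this[of undefined undefined] have cardX: "d < card X" using assms(2) by linarith
  then have X: "finite X" "X \<noteq> {}" using assms(1) by auto
  have eq: "eta2 F X n d = eta_inf F X n d"
  proof (rule antisym)
    show "eta2 F X n d \<le> eta_inf F X n d"
      unfolding eta_inf_def by (intro INF_greatest eta2_le_max_error X)
    show "eta_inf F X n d \<le> eta2 F X n d"
      unfolding eta2_def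
      by (intro Inf_greatest) (auto intro: eta_inf_le_of_lin_feasible[OF X(1) cardX dn])
  qed
  moreover have "\<exists>\<eta>. ereal \<eta> = eta_inf F X n d \<and> lin_solution F X n d \<eta> p q"
    if pq: "admissible n d p q" and mm: "minimax_solution F X n d (rat_matrix p q)"
      and nz: "\<forall>z\<in>X. poly q z \<noteq> 0" for p q
  proof -
    \<comment> \<open>The maximum is attained at a node, where \<open>q\<close> is nonzero and the
      error therefore finite; this supplies the real \<open>\<eta>\<close>.\<close>
    have "max_error F X (rat_matrix p q) \<in> node_error F (rat_matrix p q) ` X"
      unfolding max_error_def using X by (intro Max_in) auto
    then have "max_error F X (rat_matrix p q) \<noteq> \<infinity>"
      using nz by (auto simp: node_error_rat_matrix)
    then obtain \<eta> where \<eta>: "max_error F X (rat_matrix p q) = ereal \<eta>"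
      using max_error_nonneg[OF X, of F "rat_matrix p q"]
      by (cases "max_error F X (rat_matrix p q)") auto
    then have "lin_feasible F X n d \<eta> p q"
      using max_error_le_iff_lin_feasible[OF X pq, of F \<eta>] nz by simp
    moreover have "ereal \<eta> = eta_inf F X n d"
      using mm \<eta> by (simp add: minimax_solution_def)
    ultimately show ?thesis using eq by (auto simp: lin_solution_def)
  qed
  ultimately show ?thesis by blast
qed

end
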